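(* If $\mathbb{P}(\lim_{|k|\to\infty}|\boldsymbol Y_k|=0)=1$, then $\vartheta>0$, where $\vartheta=\mathbb{P}\left(\sup_{j\ge1}|\boldsymbol Y_j|\le1\right)$.
   Context: Let $|\cdot|$ be an arbitrary norm on $\mathbb{R}^d$. Let $\{\boldsymbol X_j,j\in\mathbb{Z}\}$ be a stationary $\mathbb{R}^d$-valued time series which is regularly varying: for all integers $s\le t$ there is a non-zero Radon measure $\nu_{s,t}$ on $(\mathbb{R}^d)^{[s,t]}\setminus\{\boldsymbol 0\}$ such that $\mathbb{P}(u^{-1}(\boldsymbol X_s,\dots,\boldsymbol X_t)\in\cdot)/\mathbb{P}(|\boldsymbol X_0|>u)\to\nu_{s,t}$ vaguely as $u\to\infty$. Let $\alpha>0$ be its tail index. The tail process is the random sequence $\boldsymbol Y=\{\boldsymbol Y_j,j\in\mathbb{Z}\}$ with $\mathbb{P}(|\boldsymbol Y_0|>y)=y^{-\alpha}$ for $y\ge1$ and such that, for all $s\le t$, the law of $u^{-1}(\boldsymbol X_s,\dots,\boldsymbol X_t)$ conditionally on $|\boldsymbol X_0|>u$ converges weakly to that of $(\boldsymbol Y_s,\dots,\boldsymbol Y_t)$ as $u\to\infty$. The tail measure $\nu$ is the unique Borel measure on $(\mathbb{R}^d)^{\mathbb{Z}}$ (product topology) with $\nu(\{\boldsymbol 0\})=0$ and $\nu\circ p_{s,t}^{-1}=\nu_{s,t}$ on $(\mathbb{R}^d)^{[s,t]}\setminus\{\boldsymbol 0\}$ for all $s\le t$, where $p_{s,t}$ is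 the canonical projection. It is known that $\nu$ is $\sigma$-finite, shift invariant, satisfies $\nu(c\,\cdot)=c^{-\alpha}\nu$ for all $c>0$, and $\mathbb{E}[H(\boldsymbol Y)]=\int H(\boldsymbol y)\mathbf{1}\{|\boldsymbol y_0|>1\}\,\nu(\mathrm{d}\boldsymbol y)$ for every non negative measurable $H$. *)

theory Defs
  imports "HOL-Probability.Probability"
begin

definition is_norm :: "('a::real_vector \<Rightarrow> real) \<Rightarrow> bool" where
  "is_norm N \<longleftrightarrow>
     (\<forall>x. 0 \<le> N x) \<and> (\<forall>x. N x = 0 \<longleftrightarrow> x = 0) \<and>
     (\<forall>c x. N (c *\<^sub>R x) = \<bar>c\<bar> * N x) \<and> (\<forall>x y. N (x + y) \<le> N x + N y)"

definition time_series :: "'w measure \<Rightarrow> (int \<Rightarrow> 'w \<Rightarrow> 'a::topological_space) \<Rightarrow> bool" where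
  "time_series M X \<longleftrightarrow> prob_space M \<and> (\<forall>j. X j \<in> borel_measurable M)"

definition stationary :: "'w measure \<Rightarrow> (int \<Rightarrow> 'w \<Rightarrow> 'a::topological_space) \<Rightarrow> bool" where
  "stationary M X \<longleftrightarrow>
     (\<forall>h. distr M (\<Pi>\<^sub>M j\<in>UNIV. borel) (\<lambda>\<omega> j. X (j + h) \<omega>) =
          distr M (\<Pi>\<^sub>M j\<in>UNIV. borel) (\<lambda>\<omega> j. X j \<omega>))"

text \<open>The space of families indexed by \<open>{s..t}\<close> is represented by functions on \<open>int\<close> that are
  \<open>undefined\<close> outside \<open>{s..t}\<close>, as in \<^const>\<open>PiM\<close> and \<^const>\<open>product_topology\<close>.\<close>

abbreviation window_algebra :: "int \<Rightarrow> int \<Rightarrow> (int \<Rightarrow> 'a::topological_space) measure" where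
  "window_algebra s t \<equiv> (\<Pi>\<^sub>M j\<in>{s..t}. borel)"

abbreviation window_topology :: "int \<Rightarrow> int \<Rightarrow> (int \<Rightarrow> 'a::topological_space) topology" where
  "window_topology s t \<equiv> product_topology (\<lambda>j. euclidean) {s..t}"

definition punctured_window :: "int \<Rightarrow> int \<Rightarrow> (int \<Rightarrow> 'a::real_vector) set" where
  "punctured_window s t = (\<Pi>\<^sub>E j\<in>{s..t}. UNIV) - {\<lambda>j\<in>{s..t}. 0}"

definition scaled_window ::
  "(int \<Rightarrow> 'w \<Rightarrow> 'a::real_vector) \<Rightarrow> int \<Rightarrow> int \<Rightarrow> real \<Rightarrow> 'w \<Rightarrow> (int \<Rightarrow> 'a)" where
  "scaled_window X s t u \<omega> = (\<lambda>j\<in>{s..t}. X j \<omega> /\<^sub>R u)"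

definition converges_weakly ::
  "'b topology \<Rightarrow> (real \<Rightarrow> 'b measure) \<Rightarrow> 'b measure \<Rightarrow> bool" where
  "converges_weakly T \<mu> L \<longleftrightarrow>
     (\<forall>f. continuous_map T euclideanreal f \<and> bounded (f ` topspace T) \<longrightarrow>
        ((\<lambda>u. \<integral>x. f x \<partial>\<mu> u) \<longlongrightarrow> (\<integral>x. f x \<partial>L)) at_top)"

definition converges_vaguely ::
  "'b topology \<Rightarrow> (real \<Rightarrow> 'b measure) \<Rightarrow> 'b measure \<Rightarrow> bool" where
  "converges_vaguely T \<mu> L \<longleftrightarrow>
     (\<forall>f. continuous_map T euclideanreal f \<and>
          (\<exists>K. compactin T K \<and> (\<forall>x\<in>topspace T - K. f x = 0)) \<longrightarrow>
        ((\<lambda>u. \<integral>x. f x \<partial>\<mu> u) \<longlongrightarrow> (\<integral>x. f x \<partial>L)) at_top)"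

text \<open>On a locally compact, second countable Hausdorff space, such as a punctured window, a Borel
  measure that is finite on compact sets is automatically regular, so local finiteness is all that
  has to be required of a Radon measure. The compact sets of a punctured window are both bounded
  and bounded away from 0. For a stationary series, convergence against the larger class of bounded
  continuous functions supported away from 0 gives the same notion of regular variation.\<close>

definition regularly_varying ::
  "'w measure \<Rightarrow> ('a::real_normed_vector \<Rightarrow> real) \<Rightarrow> (int \<Rightarrow> 'w \<Rightarrow> 'a) \<Rightarrow> bool" where
  "regularly_varying M N X \<longleftrightarrow>
     (\<forall>s t. s \<le> t \<longrightarrow>
       (let E = punctured_window s t;
            T = subtopology (window_topology s t) E
        in \<exists>\<nu>. sets \<nu> = sets (restrict_space (window_algebra s t) E) \<and>
             (\<forall>K. compactin T K \<longrightarrow> emeasure \<nu> K < \<infinity>) \<and>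
             emeasure \<nu> E \<noteq> 0 \<and>
             converges_vaguely T
               (\<lambda>u. scale_measure (ennreal (1 / \<P>(\<omega> in M. N (X 0 \<omega>) > u)))
                  (restrict_space (distr M (window_algebra s t) (scaled_window X s t u)) E))
               \<nu>))"

definition tail_index ::
  "'w measure \<Rightarrow> ('a \<Rightarrow> real) \<Rightarrow> (int \<Rightarrow> 'w \<Rightarrow> 'a) \<Rightarrow> real \<Rightarrow> bool" where
  "tail_index M N X \<alpha> \<longleftrightarrow>
     (\<forall>c>0. ((\<lambda>u. \<P>(\<omega> in M. N (X 0 \<omega>) > c * u) / \<P>(\<omega> in M. N (X 0 \<omega>) > u))
               \<longlongrightarrow> c powr (- \<alpha>)) at_top)"

text \<open>The tail process is determined only in law, so \<open>Y\<close> may live on any probability space.\<close>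

definition tail_process ::
  "'w measure \<Rightarrow> ('a::real_normed_vector \<Rightarrow> real) \<Rightarrow> (int \<Rightarrow> 'w \<Rightarrow> 'a) \<Rightarrow> real \<Rightarrow>
   'v measure \<Rightarrow> (int \<Rightarrow> 'v \<Rightarrow> 'a) \<Rightarrow> bool" where
  "tail_process M N X \<alpha> P Y \<longleftrightarrow>
     time_series P Y \<and>
     (\<forall>y\<ge>1. \<P>(\<omega> in P. N (Y 0 \<omega>) > y) = y powr (- \<alpha>)) \<and>
     (\<forall>s t. s \<le> t \<longrightarrow>
       converges_weakly (window_topology s t)
         (\<lambda>u. distr (uniform_measure M {\<omega>\<in>space M. N (X 0 \<omega>) > u})
                (window_algebra s t) (scaled_window X s t u))
         (distr P (window_algebra s t) (\<lambda>\<omega>. \<lambda>j\<in>{s..t}. Y j \<omega>)))"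

definition vartheta :: "'v measure \<Rightarrow> ('a \<Rightarrow> real) \<Rightarrow> (int \<Rightarrow> 'v \<Rightarrow> 'a) \<Rightarrow> real" where
  "vartheta P N Y = \<P>(\<omega> in P. (SUP j\<in>{1..}. ereal (N (Y j \<omega>))) \<le> 1)"

end

theory Submission
  imports Defs
begin

text \<open>Write \<open>|x|\<close> for \<open>N x\<close>. Since \<open>|Y 0| > 1\<close> and \<open>|Y k| \<rightarrow> 0\<close> almost surely, there is almost surely
  a last time \<open>k \<ge> 0\<close> with \<open>|Y k| > 1\<close> (\<open>last_exceedance_exists\<close>). It therefore suffices that, for
  each fixed \<open>k\<close>, the event that \<open>k\<close> is the time of the last exceedance has probability at most
  \<open>\<vartheta>\<close> (\<open>prob_last_exceedance_le\<close>): if \<open>\<vartheta>\<close> were zero, an almost sure event would be covered by countably many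
  null events.

  In terms of the tail measure \<open>\<nu>\<close>, that bound only drops a constraint and shifts:
  \<open>\<nu>(|y 0| > 1, |y k| > 1, |y (k + j)| \<le> 1 for j \<ge> 1) \<le> \<nu>(|y 0| > 1, |y j| \<le> 1 for j \<ge> 1) = \<vartheta>\<close>.
  The same two steps can be made before passing to the limit, so that \<open>\<nu>\<close> does not appear: for the
  original series, dropping \<open>|X 0| > u\<close> while keeping \<open>|X k| > u\<close> and shifting by stationarity leads
  from the numerator of one conditional expectation given \<open>|X 0| > u\<close> to that of another, and both
  converge to expectations under the law of the tail process (\<open>tail_process_shift_le\<close>).

  Weak convergence only sees continuous functions, and \<open>|Y j| = 1\<close> might have positive
  probability. The comparison is therefore made for a continuous function \<open>\<phi>\<close> in place of the indicator of
  \<open>(1, \<infinity>)\<close>. Dropping \<open>|X 0| > u\<close> asks only that \<open>\<phi>\<close> lie below that indicator, so \<open>\<phi>\<close> can be taken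
  to increase to it; \<open>1 - \<phi>\<close> then decreases to the indicator of \<open>(-\<infinity>, 1]\<close>, and the comparison
  passes to the limit with no loss on the boundary.\<close>

section \<open>Continuity of norms, conditional expectations and stationarity\<close>

lemma is_norm_continuous_on:
  fixes N :: "'a::euclidean_space \<Rightarrow> real"
  assumes "is_norm N"
  shows "continuous_on A N"
proof -
  have "convex_on UNIV N"
  proof (intro convex_onI)
    fix t :: real and x y :: 'a
    assume "0 < t" "t < 1"
    have "N ((1 - t) *\<^sub>R x + t *\<^sub>R y) \<le> N ((1 - t) *\<^sub>R x) + N (t *\<^sub>R y)"
      using assms unfolding is_norm_def by blast
    also have "\<dots> = (1 - t) * N x + t * N y"
      using assms \<open>0 < t\<close> \<open>t < 1\<close> by (simp add: is_norm_def)
    finally show "N ((1 - t) *\<^sub>R x + t *\<^sub>R y) \<le> (1 - t) * N x + t * N y" .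
  qed simp
  then have "continuous_on UNIV N"
    by (intro convex_on_continuous) auto
  then show ?thesis
    by (rule continuous_on_subset) simp
qed

text \<open>The equation includes the case \<open>measure M B = 0\<close>: the uniform measure is then the zero measure,
  and the right-hand side is zero as a division by zero.\<close>

lemma integral_uniform_measure:
  fixes f :: "'a \<Rightarrow> real"
  assumes "finite_measure M" and [measurable]: "B \<in> sets M" "f \<in> borel_measurable M"
  shows "(\<integral>x. f x \<partial>uniform_measure M B) = (\<integral>x. f x * indicator B x \<partial>M) / measure M B"
proof -
  interpret finite_measure M by fact
  show ?thesis
  proof (cases "measure M B = 0")
    case True
    then have "emeasure M B = 0"
      by (simp add: emeasure_eq_measure)
    then have "AE x in uniform_measure M B. f x = 0"
      by (intro AE_I[where N = "space M"]) auto
    with True show ?thesis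
      using integral_cong_AE[of f "uniform_measure M B" "\<lambda>_. 0"] by simp
  next
    case False
    then have pos: "measure M B > 0"
      by (simp add: zero_less_measure_iff)
    have "uniform_measure M B = density M (\<lambda>x. ennreal (indicator B x / measure M B))"
      unfolding uniform_measure_def emeasure_eq_measure
      using pos by (intro arg_cong[where f = "density M"] ext) (auto simp: indicator_def divide_ennreal
          simp flip: ennreal_1)
    then have "(\<integral>x. f x \<partial>uniform_measure M B) = (\<integral>x. indicator B x / measure M B * f x \<partial>M)"
      by (simp add: integral_density)
    then show ?thesis
      by (simp add: mult.commute flip: integral_divide_zero)
  qed
qed

lemma stationary_integral_shift:
  fixes X :: "int \<Rightarrow> 'w \<Rightarrow> 'a::topological_space" and G :: "(int \<Rightarrow> 'a) \<Rightarrow> real"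
  assumes "time_series M X" "stationary M X"
    and G[measurable]: "G \<in> borel_measurable (\<Pi>\<^sub>M j\<in>UNIV. borel)"
  shows "(\<integral>\<omega>. G (\<lambda>j. X (j + h) \<omega>) \<partial>M) = (\<integral>\<omega>. G (\<lambda>j. X j \<omega>) \<partial>M)"
proof -
  have [measurable]: "X j \<in> borel_measurable M" for j
    using assms(1) by (simp add: time_series_def)
  have "(\<integral>\<omega>. G (\<lambda>j. X (j + i) \<omega>) \<partial>M)
      = (\<integral>x. G x \<partial>distr M (\<Pi>\<^sub>M j\<in>UNIV. borel) (\<lambda>\<omega> j. X (j + i) \<omega>))" for i
    by (subst integral_distr) (auto intro!: measurable_PiM_single' simp: space_PiM)
  from this[of h] this[of 0] show ?thesis
    using assms(2) by (simp add: stationary_def)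
qed

section \<open>Change of time origin for the tail process\<close>

text \<open>The weak convergence that defines the tail process, with the conditional expectations written
  as quotients, so that numerators for different windows can be compared over the common
  denominator \<open>\<P>(|X 0| > u)\<close>.\<close>

lemma tail_process_integral_limit:
  fixes X :: "int \<Rightarrow> 'w \<Rightarrow> 'a::real_normed_vector"
  assumes "time_series M X" "tail_process M N X \<alpha> P Y" "s \<le> t"
    and N[measurable]: "N \<in> borel_measurable borel"
    and "continuous_map (window_topology s t) euclideanreal f"
    and "\<And>x. \<bar>f x\<bar> \<le> C"
    and f[measurable]: "f \<in> borel_measurable (window_algebra s t)"
  shows "((\<lambda>u. (\<integral>\<omega>. f (scaled_window X s t u \<omega>) * indicator {\<omega>\<in>space M. N (X 0 \<omega>) > u} \<omega> \<partial>M)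
              / \<P>(\<omega> in M. N (X 0 \<omega>) > u))
            \<longlongrightarrow> (\<integral>\<omega>. f (\<lambda>j\<in>{s..t}. Y j \<omega>) \<partial>P)) at_top"
proof -
  have [measurable]: "X j \<in> borel_measurable M" "Y j \<in> borel_measurable P" for j
    using assms(1,2) by (simp_all add: time_series_def tail_process_def)
  interpret prob_space M
    using assms(1) by (simp add: time_series_def)
  have [measurable]: "scaled_window X s t u \<in> measurable M (window_algebra s t)" for u
    unfolding scaled_window_def[abs_def] by measurable
  have "bounded (f ` topspace (window_topology s t))"
    using assms(6) by (auto simp: bounded_iff)
  with assms(2,3,5)
  have "((\<lambda>u. \<integral>x. f x \<partial>distr (uniform_measure M {\<omega>\<in>space M. N (X 0 \<omega>) > u})
                (window_algebra s t) (scaled_window X s t u))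
       \<longlongrightarrow> (\<integral>x. f x \<partial>distr P (window_algebra s t) (\<lambda>\<omega>. \<lambda>j\<in>{s..t}. Y j \<omega>))) at_top"
    by (simp add: tail_process_def converges_weakly_def)
  moreover have "(\<integral>x. f x \<partial>distr (uniform_measure M {\<omega>\<in>space M. N (X 0 \<omega>) > u})
                (window_algebra s t) (scaled_window X s t u))
     = (\<integral>\<omega>. f (scaled_window X s t u \<omega>) * indicator {\<omega>\<in>space M. N (X 0 \<omega>) > u} \<omega> \<partial>M)
              / \<P>(\<omega> in M. N (X 0 \<omega>) > u)" for u
    by (simp add: integral_distr integral_uniform_measure finite_measure_axioms)
  moreover have "(\<integral>x. f x \<partial>distr P (window_algebra s t) (\<lambda>\<omega>. \<lambda>j\<in>{s..t}. Y j \<omega>))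
     = (\<integral>\<omega>. f (\<lambda>j\<in>{s..t}. Y j \<omega>) \<partial>P)"
    by (subst integral_distr) simp_all
  ultimately show ?thesis
    by simp
qed

text \<open>The change of time origin from \<open>0\<close> to \<open>k\<close>, as an inequality. Because \<open>\<phi>\<close> lies below the
  indicator of \<open>(1, \<infinity>)\<close>, the factor \<open>\<phi> (|X k| / u)\<close> is at most the indicator of \<open>|X k| > u\<close>; once
  \<open>|X 0| > u\<close> has been dropped, shifting by \<open>k\<close> makes \<open>|X k| > u\<close> the new conditioning event.\<close>

lemma tail_process_shift_le:
  fixes X :: "int \<Rightarrow> 'w \<Rightarrow> 'a::euclidean_space" and Y :: "int \<Rightarrow> 'v \<Rightarrow> 'a"
  assumes norm: "is_norm N" and ts: "time_series M X" and st: "stationary M X"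
    and tp: "tail_process M N X \<alpha> P Y" and m: "0 \<le> m"
    and \<phi>: "continuous_on UNIV \<phi>" "\<And>x. 0 \<le> \<phi> x" "\<And>x. \<phi> x \<le> 1" "\<And>x. x \<le> 1 \<Longrightarrow> \<phi> x = 0"
    and \<psi>: "continuous_on UNIV \<psi>" "\<And>x. 0 \<le> \<psi> x" "\<And>x. \<psi> x \<le> (1::real)"
  shows "(\<integral>\<omega>. \<phi> (N (Y k \<omega>)) * (\<Prod>j\<in>{1..m}. \<psi> (N (Y (k + j) \<omega>))) \<partial>P)
       \<le> (\<integral>\<omega>. (\<Prod>j\<in>{1..m}. \<psi> (N (Y j \<omega>))) \<partial>P)"
proof -
  interpret prob_space M
    using ts by (simp add: time_series_def)
  have [measurable]: "X j \<in> borel_measurable M" for j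
    using ts by (simp add: time_series_def)
  have N_cont: "continuous_on UNIV N"
    by (rule is_norm_continuous_on[OF norm])
  have [measurable]: "N \<in> borel_measurable borel" "\<phi> \<in> borel_measurable borel" "\<psi> \<in> borel_measurable borel"
    by (intro borel_measurable_continuous_onI N_cont \<phi>(1) \<psi>(1))+
  have N_scale: "N (x /\<^sub>R u) = N x / u" if "u > 0" for x u
    using norm that by (simp add: is_norm_def divide_inverse mult.commute)
  have prod01: "0 \<le> (\<Prod>j\<in>{1..m}. \<psi> (a j))" "(\<Prod>j\<in>{1..m}. \<psi> (a j)) \<le> 1" for a
    by (auto intro: prod_nonneg prod_le_1 simp: \<psi>)
  have coord: "continuous_map (window_topology s t) euclideanreal (\<lambda>x. g (N (x i)))"
    if "i \<in> {s..t}" "continuous_on UNIV g" for i s t and g :: "real \<Rightarrow> real"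
  proof -
    have "continuous_map euclidean euclideanreal (\<lambda>y. g (N y))"
      using continuous_on_compose2[OF that(2) N_cont] by simp
    from continuous_map_compose[OF continuous_map_product_projection[OF that(1), where X="\<lambda>_. euclidean"] this]
    show ?thesis by (simp add: o_def)
  qed
  have coord_measurable: "(\<lambda>x. g (N (x i))) \<in> borel_measurable (window_algebra s t)"
    if "i \<in> {s..t}" "g \<in> borel_measurable borel" for i s t and g :: "real \<Rightarrow> real"
    using measurable_component_singleton[OF that(1), of "\<lambda>_. borel"]
    by (rule measurable_compose) (use that(2) in simp)
  let ?p = "\<lambda>u. \<P>(\<omega> in M. N (X 0 \<omega>) > u)"
  let ?B = "\<lambda>u. {\<omega>\<in>space M. N (X 0 \<omega>) > u}"
  define F where "F x = \<phi> (N (x k)) * (\<Prod>j\<in>{1..m}. \<psi> (N (x (k + j))))" for x :: "int \<Rightarrow> 'a"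
  define G where "G x = (\<Prod>j\<in>{1..m}. \<psi> (N (x j)))" for x :: "int \<Rightarrow> 'a"
  have [measurable]: "F \<in> borel_measurable (window_algebra k (k + m))"
    unfolding F_def[abs_def] using m
    by (intro borel_measurable_times borel_measurable_prod coord_measurable) auto
  have [measurable]: "G \<in> borel_measurable (window_algebra 0 m)"
    unfolding G_def[abs_def] using m
    by (intro borel_measurable_prod coord_measurable) auto
  have F_bound: "\<bar>F x\<bar> \<le> 1" and F_nonneg: "0 \<le> F x" for x
    using prod01 by (auto simp: F_def \<phi> abs_mult intro!: mult_le_one)
  have G_bound: "\<bar>G x\<bar> \<le> 1" for x
    using prod01 by (auto simp: G_def)
  have "((\<lambda>u. (\<integral>\<omega>. F (scaled_window X k (k + m) u \<omega>) * indicator (?B u) \<omega> \<partial>M) / ?p u)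
          \<longlongrightarrow> (\<integral>\<omega>. F (\<lambda>j\<in>{k..k + m}. Y j \<omega>) \<partial>P)) at_top"
    by (rule tail_process_integral_limit[OF ts tp _ _ _ F_bound])
       (use m in \<open>auto simp: F_def[abs_def] intro!: continuous_map_real_mult continuous_map_prod coord \<phi> \<psi>\<close>)
  moreover have "((\<lambda>u. (\<integral>\<omega>. G (scaled_window X 0 m u \<omega>) * indicator (?B u) \<omega> \<partial>M) / ?p u)
          \<longlongrightarrow> (\<integral>\<omega>. G (\<lambda>j\<in>{0..m}. Y j \<omega>) \<partial>P)) at_top"
    by (rule tail_process_integral_limit[OF ts tp _ _ _ G_bound])
       (use m in \<open>auto simp: G_def[abs_def] intro!: continuous_map_prod coord \<psi>\<close>)
  moreover have "\<forall>\<^sub>F u in at_top.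
      (\<integral>\<omega>. F (scaled_window X k (k + m) u \<omega>) * indicator (?B u) \<omega> \<partial>M) / ?p u
    \<le> (\<integral>\<omega>. G (scaled_window X 0 m u \<omega>) * indicator (?B u) \<omega> \<partial>M) / ?p u"
    using eventually_gt_at_top[of 0]
  proof eventually_elim
    case (elim u)
    \<comment> \<open>The integrand seen from the new origin, as a function of the whole path so that stationarity
      applies to it: unlike \<open>F\<close>, it carries the sharp indicator, which becomes the conditioning event.\<close>
    define H where "H x = indicator {z. N z > u} (x 0) * (\<Prod>j\<in>{1..m}. \<psi> (N (x j) / u))"
      for x :: "int \<Rightarrow> 'a"
    have [measurable]: "H \<in> borel_measurable (\<Pi>\<^sub>M j\<in>UNIV. borel)"
      unfolding H_def[abs_def] by measurable
    have H_bound: "\<bar>H x\<bar> \<le> 1" for x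
      using prod01 by (auto simp: H_def indicator_def)
    have "(\<integral>\<omega>. F (scaled_window X k (k + m) u \<omega>) * indicator (?B u) \<omega> \<partial>M)
        \<le> (\<integral>\<omega>. H (\<lambda>j. X (j + k) \<omega>) \<partial>M)"
    proof (rule integral_mono)
      show "integrable M (\<lambda>\<omega>. H (\<lambda>j. X (j + k) \<omega>))"
      proof (rule integrable_const_bound[where B = 1])
        show "AE \<omega> in M. norm (H (\<lambda>j. X (j + k) \<omega>)) \<le> 1"
          using H_bound by simp
        show "(\<lambda>\<omega>. H (\<lambda>j. X (j + k) \<omega>)) \<in> borel_measurable M"
          unfolding H_def by measurable
      qed
      show "integrable M (\<lambda>\<omega>. F (scaled_window X k (k + m) u \<omega>) * indicator (?B u) \<omega>)"
        by (rule integrable_const_bound[where B = 1])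
           (use F_bound in \<open>auto simp: indicator_def scaled_window_def[abs_def]\<close>)
      fix \<omega>
      have "F (scaled_window X k (k + m) u \<omega>)
          = \<phi> (N (X k \<omega>) / u) * (\<Prod>j\<in>{1..m}. \<psi> (N (X (j + k) \<omega>) / u))"
        using m elim by (auto simp: F_def scaled_window_def N_scale add.commute intro!: prod.cong)
      also have "\<dots> \<le> H (\<lambda>j. X (j + k) \<omega>)"
        using elim prod01 \<phi>(3,4) by (auto simp: H_def indicator_def intro!: mult_left_le_one_le \<phi>)
      finally show "F (scaled_window X k (k + m) u \<omega>) * indicator (?B u) \<omega> \<le> H (\<lambda>j. X (j + k) \<omega>)"
        using F_nonneg[of "scaled_window X k (k + m) u \<omega>"] by (auto simp: indicator_def)
    qed
    also have "\<dots> = (\<integral>\<omega>. H (\<lambda>j. X j \<omega>) \<partial>M)"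
      by (rule stationary_integral_shift[OF ts st]) simp
    also have "\<dots> = (\<integral>\<omega>. G (scaled_window X 0 m u \<omega>) * indicator (?B u) \<omega> \<partial>M)"
      using m elim
      by (intro Bochner_Integration.integral_cong)
         (auto simp: G_def H_def scaled_window_def N_scale indicator_def intro!: prod.cong)
    finally show ?case
      by (rule divide_right_mono) simp
  qed
  ultimately have "(\<integral>\<omega>. F (\<lambda>j\<in>{k..k + m}. Y j \<omega>) \<partial>P) \<le> (\<integral>\<omega>. G (\<lambda>j\<in>{0..m}. Y j \<omega>) \<partial>P)"
    using tendsto_le[OF trivial_limit_at_top_linorder] by blast
  moreover have "F (\<lambda>j\<in>{k..k + m}. Y j \<omega>) = \<phi> (N (Y k \<omega>)) * (\<Prod>j\<in>{1..m}. \<psi> (N (Y (k + j) \<omega>)))" for \<omega>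
    using m by (auto simp: F_def intro!: prod.cong)
  moreover have "G (\<lambda>j\<in>{0..m}. Y j \<omega>) = (\<Prod>j\<in>{1..m}. \<psi> (N (Y j \<omega>)))" for \<omega>
    using m by (auto simp: G_def intro!: prod.cong)
  ultimately show ?thesis
    by simp
qed

section \<open>The last exceedance\<close>

text \<open>Continuous functions increasing to the indicator of the open half-line \<open>(1, \<infinity>)\<close>.\<close>

definition ramp :: "nat \<Rightarrow> real \<Rightarrow> real" where
  "ramp n x = min 1 (real n * max 0 (x - 1))"

lemma ramp_continuous: "continuous_on UNIV (ramp n)"
  unfolding ramp_def[abs_def] by (intro continuous_intros)

lemma ramp_bounds: "0 \<le> ramp n x" "ramp n x \<le> 1"
  by (simp_all add: ramp_def)

lemma ramp_eq_0: "x \<le> 1 \<Longrightarrow> ramp n x = 0"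
  by (simp add: ramp_def)

lemma eventually_ramp_eq_1:
  assumes "x > 1"
  shows "\<forall>\<^sub>F n in sequentially. ramp n x = 1"
proof -
  obtain n0 :: nat where "1 / (x - 1) < n0"
    using reals_Archimedean2 by blast
  then have n0: "1 < real n0 * (x - 1)"
    using assms by (simp add: divide_less_eq)
  have "ramp n x = 1" if "n \<ge> n0" for n
  proof -
    have "real n0 * (x - 1) \<le> real n * (x - 1)"
      using assms that by (intro mult_right_mono) auto
    with n0 have "1 < real n * (x - 1)"
      by simp
    with assms show ?thesis
      by (simp add: ramp_def)
  qed
  then show ?thesis
    by (auto simp: eventually_sequentially)
qed

lemma ramp_tendsto: "(\<lambda>n. ramp n x) \<longlonglongrightarrow> (if x > 1 then 1 else 0)"
  using tendsto_eventually[OF eventually_ramp_eq_1[of x]] by (auto simp: ramp_eq_0)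

text \<open>The number of factors and their sharpness may grow together: if some \<open>a i > 1\<close>, then the
  factor of index \<open>i\<close> is eventually present and exactly zero.\<close>

lemma prod_one_minus_ramp_tendsto:
  "(\<lambda>n. \<Prod>j\<in>{1..int n}. 1 - ramp n (a j)) \<longlonglongrightarrow> (if \<forall>j\<ge>1. a j \<le> 1 then 1 else 0)"
proof (cases "\<forall>j\<ge>1. a j \<le> 1")
  case True
  then show ?thesis
    by (simp add: ramp_eq_0)
next
  case False
  then obtain i where i: "i \<ge> 1" "a i > 1"
    by force
  have "\<forall>\<^sub>F n in sequentially. (\<Prod>j\<in>{1..int n}. 1 - ramp n (a j)) = 0"
    using eventually_ramp_eq_1[OF i(2)] eventually_ge_at_top[of "nat i"]
  proof eventually_elim
    case (elim n)
    then show ?case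
      using i(1) by (intro prod_zero) (auto intro!: bexI[of _ i])
  qed
  then have "(\<lambda>n. \<Prod>j\<in>{1..int n}. 1 - ramp n (a j)) \<longlonglongrightarrow> 0"
    by (rule tendsto_eventually)
  then show ?thesis
    by (subst if_not_P[OF False])
qed

text \<open>The limit of \<open>tail_process_shift_le\<close> for \<open>\<phi> = ramp n\<close>, \<open>\<psi> = 1 - ramp n\<close> and \<open>m = n\<close>: a single
  dominated convergence sharpens the indicators and lengthens the window at once.\<close>

lemma prob_last_exceedance_le:
  fixes X :: "int \<Rightarrow> 'w \<Rightarrow> 'a::euclidean_space" and Y :: "int \<Rightarrow> 'v \<Rightarrow> 'a"
  assumes norm: "is_norm N" and ts: "time_series M X" and st: "stationary M X"
    and tp: "tail_process M N X \<alpha> P Y"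
  shows "\<P>(\<omega> in P. N (Y k \<omega>) > 1 \<and> (\<forall>j\<ge>1. N (Y (k + j) \<omega>) \<le> 1))
       \<le> \<P>(\<omega> in P. \<forall>j\<ge>1. N (Y j \<omega>) \<le> 1)"
proof -
  interpret P: prob_space P
    using tp by (simp add: tail_process_def time_series_def)
  have [measurable]: "Y j \<in> borel_measurable P" for j
    using tp by (simp add: tail_process_def time_series_def)
  have [measurable]: "N \<in> borel_measurable borel" "ramp n \<in> borel_measurable borel" for n
    by (intro borel_measurable_continuous_onI is_norm_continuous_on[OF norm] ramp_continuous)+
  have prod01: "0 \<le> (\<Prod>j\<in>J. 1 - ramp n (a j))" "(\<Prod>j\<in>J. 1 - ramp n (a j)) \<le> 1"
    for J :: "int set" and n a
    by (auto intro: prod_nonneg prod_le_1 simp: ramp_bounds)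
  have lim: "(\<lambda>n. ramp n (N (Y k \<omega>)) * (\<Prod>j\<in>{1..int n}. 1 - ramp n (N (Y (k + j) \<omega>))))
     \<longlonglongrightarrow> (if N (Y k \<omega>) > 1 then 1 else 0 :: real)
            * (if \<forall>j\<ge>1. N (Y (k + j) \<omega>) \<le> 1 then 1 else 0 :: real)" for \<omega>
    by (intro tendsto_mult ramp_tendsto prod_one_minus_ramp_tendsto)
  have "(\<lambda>n. \<integral>\<omega>. ramp n (N (Y k \<omega>)) * (\<Prod>j\<in>{1..int n}. 1 - ramp n (N (Y (k + j) \<omega>))) \<partial>P)
     \<longlonglongrightarrow> (\<integral>\<omega>. (if N (Y k \<omega>) > 1 then 1 else 0 :: real)
            * (if \<forall>j\<ge>1. N (Y (k + j) \<omega>) \<le> 1 then 1 else 0 :: real) \<partial>P)"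
    by (rule integral_dominated_convergence[where w = "\<lambda>_. 1"])
       (use lim in \<open>auto simp: abs_mult ramp_bounds prod01 simp del: mult_if_delta
          intro!: mult_le_one AE_I2\<close>)
  moreover have "(\<lambda>n. \<integral>\<omega>. (\<Prod>j\<in>{1..int n}. 1 - ramp n (N (Y j \<omega>))) \<partial>P)
     \<longlonglongrightarrow> (\<integral>\<omega>. (if \<forall>j\<ge>1. N (Y j \<omega>) \<le> 1 then 1 else 0 :: real) \<partial>P)"
    by (rule integral_dominated_convergence[where w = "\<lambda>_. 1"])
       (use prod_one_minus_ramp_tendsto in \<open>auto simp: prod01 simp del: if_split intro!: AE_I2\<close>)
  ultimately have "(\<integral>\<omega>. (if N (Y k \<omega>) > 1 then 1 else 0 :: real)
            * (if \<forall>j\<ge>1. N (Y (k + j) \<omega>) \<le> 1 then 1 else 0 :: real) \<partial>P)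
       \<le> (\<integral>\<omega>. (if \<forall>j\<ge>1. N (Y j \<omega>) \<le> 1 then 1 else 0 :: real) \<partial>P)"
    by (rule LIMSEQ_le)
       (intro exI[of _ 0] allI impI tail_process_shift_le[OF norm ts st tp];
        auto simp: ramp_bounds ramp_eq_0 intro!: continuous_intros ramp_continuous)
  moreover have "(\<integral>\<omega>. (if N (Y k \<omega>) > 1 then 1 else 0 :: real)
            * (if \<forall>j\<ge>1. N (Y (k + j) \<omega>) \<le> 1 then 1 else 0 :: real) \<partial>P)
      = (\<integral>\<omega>. indicator {\<omega>\<in>space P. N (Y k \<omega>) > 1 \<and> (\<forall>j\<ge>1. N (Y (k + j) \<omega>) \<le> 1)} \<omega> \<partial>P)"
    by (intro Bochner_Integration.integral_cong) (auto simp: indicator_def)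
  moreover have "(\<integral>\<omega>. (if \<forall>j\<ge>1. N (Y j \<omega>) \<le> 1 then 1 else 0 :: real) \<partial>P)
      = (\<integral>\<omega>. indicator {\<omega>\<in>space P. \<forall>j\<ge>1. N (Y j \<omega>) \<le> 1} \<omega> \<partial>P)"
    by (intro Bochner_Integration.integral_cong) (auto simp: indicator_def)
  ultimately show ?thesis
    by simp
qed

lemma vartheta_eq: "vartheta P N Y = \<P>(\<omega> in P. \<forall>j\<ge>1. N (Y j \<omega>) \<le> 1)"
  by (simp add: vartheta_def SUP_le_iff Ball_def)

lemma last_exceedance_exists:
  fixes a :: "int \<Rightarrow> real"
  assumes "(a \<longlongrightarrow> 0) (filtercomap abs at_top)" "a 0 > 1"
  obtains k :: nat where "a (int k) > 1" "\<And>j. j \<ge> 1 \<Longrightarrow> a (int k + j) \<le> 1"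
proof -
  have "\<forall>\<^sub>F k in filtercomap abs at_top. a k < 1"
    using order_tendstoD(2)[OF assms(1), of 1] by simp
  then obtain n where n: "\<And>k. \<bar>k\<bar> \<ge> n \<Longrightarrow> a k < 1"
    unfolding eventually_filtercomap eventually_at_top_linorder by blast
  have bound: "k \<le> nat \<bar>n\<bar>" if "a (int k) > 1" for k
    using that n[of "int k"] by force
  let ?k = "GREATEST k. a (int k) > 1"
  have "a (int ?k) > 1"
    by (rule GreatestI_nat[of "\<lambda>k. a (int k) > 1" 0]) (use assms(2) bound in auto)
  moreover have "a (int ?k + j) \<le> 1" if "j \<ge> 1" for j
  proof (rule ccontr)
    assume "\<not> a (int ?k + j) \<le> 1"
    then have "a (int (?k + nat j)) > 1"
      using that by simp
    then have "?k + nat j \<le> ?k"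
      by (rule Greatest_le_nat) (use bound in auto)
    with that show False by simp
  qed
  ultimately show ?thesis
    using that by blast
qed

theorem lemma3p4:
  fixes N :: "real ^ 'd \<Rightarrow> real"
    and M :: "'w measure" and X :: "int \<Rightarrow> 'w \<Rightarrow> real ^ 'd"
    and P :: "'v measure" and Y :: "int \<Rightarrow> 'v \<Rightarrow> real ^ 'd"
    and \<alpha> :: real
  assumes "is_norm N"
    and "time_series M X"
    and "stationary M X"
    and "regularly_varying M N X"
    and "\<alpha> > 0"
    and "tail_index M N X \<alpha>"
    and "tail_process M N X \<alpha> P Y"
    and "\<P>(\<omega> in P. ((\<lambda>k. N (Y k \<omega>)) \<longlongrightarrow> 0) (filtercomap abs at_top)) = 1"
  shows "vartheta P N Y > 0"
proof (rule ccontr)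
  assume "\<not> vartheta P N Y > 0"
  then have zero: "\<P>(\<omega> in P. \<forall>j\<ge>1. N (Y j \<omega>) \<le> 1) = 0"
    by (simp add: vartheta_eq zero_less_measure_iff)
  interpret P: prob_space P
    using assms(7) by (simp add: tail_process_def time_series_def)
  have [measurable]: "Y j \<in> borel_measurable P" for j
    using assms(7) by (simp add: tail_process_def time_series_def)
  have [measurable]: "N \<in> borel_measurable borel"
    by (intro borel_measurable_continuous_onI is_norm_continuous_on assms(1))
  let ?Z = "{\<omega> \<in> space P. ((\<lambda>k. N (Y k \<omega>)) \<longlongrightarrow> 0) (filtercomap abs at_top)}"
  have "?Z \<in> P.events"
    using assms(8) measure_notin_sets[of ?Z P] by (cases "?Z \<in> P.events") auto
  then have "AE \<omega> in P. ((\<lambda>k. N (Y k \<omega>)) \<longlongrightarrow> 0) (filtercomap abs at_top)"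
    using assms(8) by (simp add: P.prob_Collect_eq_1)
  moreover have "AE \<omega> in P. N (Y 0 \<omega>) > 1"
    using assms(7) by (subst P.prob_Collect_eq_1[symmetric]) (auto simp: tail_process_def)
  moreover have "AE \<omega> in P. \<forall>k::nat. \<not> (N (Y (int k) \<omega>) > 1 \<and> (\<forall>j\<ge>1. N (Y (int k + j) \<omega>) \<le> 1))"
  proof (subst AE_all_countable, rule allI)
    fix k :: nat
    have "\<P>(\<omega> in P. N (Y (int k) \<omega>) > 1 \<and> (\<forall>j\<ge>1. N (Y (int k + j) \<omega>) \<le> 1)) = 0"
      using prob_last_exceedance_le[OF assms(1-3,7), of "int k"] zero
      by (simp add: measure_le_0_iff)
    then show "AE \<omega> in P. \<not> (N (Y (int k) \<omega>) > 1 \<and> (\<forall>j\<ge>1. N (Y (int k + j) \<omega>) \<le> 1))"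
      by (subst P.prob_Collect_eq_0[symmetric]) auto
  qed
  ultimately have "AE \<omega> in P. False"
  proof eventually_elim
    case (elim \<omega>)
    show ?case
      by (rule last_exceedance_exists[OF elim(1,2)]) (use elim(3) in blast)
  qed
  then show False
    by simp
qed

end
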